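(* Let $\mathcal{H}$ be a real Hilbert space, let $m\geq 1$ and $r\geq 2$ be integers, and let $C_0,C_1,\ldots,C_{m-1}\subseteq\mathcal{H}$ be nonempty, closed and convex sets with $\operatorname{int}\left(\bigcap_{i=0}^{m-1}C_i\right)\neq\emptyset$. Let $\{S_k\}_{k=1}^{\infty}$ be the family of cyclic $r$-sets-Douglas-Rachford operators associated with $C_0,\ldots,C_{m-1}$ and $r$ (defined in the context), and let $\{x^k\}_{k=0}^{\infty}$ be a sequence generated from an arbitrary $x^0\in\mathcal{H}$ by $x^{k+1}=S_{k+1}(x^k)$ for all $k\geq 0$. Assume that $S:\mathcal{H}\to\mathcal{H}$ is a nonexpansive operator with $\operatorname{Fix}(S)\neq\emptyset$ for which the following hold: (1) $\operatorname{Fix}(S)\subseteq\left(\bigcap_{k=1}^{\infty}\operatorname{Fix}(S_k)\right)\cap\left(\bigcap_{i=0}^{m-1}C_i\right)$; (2) $\{x^k\}_{k=0}^{\infty}$ is Fejér-monotone with respect to $\operatorname{Fix}(S)$; (3) there is some $\beta>0$ such that $\Vert S_{k+1}(x^k)-x^k\Vert\geq\beta\Vert S(x^k)-x^k\Vert$ for all $k\geq 0$. Then the sequence $\{x^k\}_{k=0}^{\infty}$ converges weakly to a point $x^{\ast}\in\operatorname{Fix}(S)$, and, in particular, $x^{\ast}\in\bigcap_{i=0}^{m-1}C_i$.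
   Context: For a nonempty closed convex set $D\subseteq\mathcal{H}$, $P_D$ denotes the metric (orthogonal) projection onto $D$, $\mathrm{Id}$ the identity operator on $\mathcal{H}$, and $\mathcal{R}_D:=2P_D-\mathrm{Id}$ the reflection with respect to $D$. For a finite sequence of $r\geq 2$ nonempty closed convex sets $D_0,D_1,\ldots,D_{r-1}\subseteq\mathcal{H}$, the composite reflection operator is $\mathcal{V}_{D_0,\ldots,D_{r-1}}:=\mathcal{R}_{D_{r-1}}\mathcal{R}_{D_{r-2}}\cdots\mathcal{R}_{D_0}$ (so $\mathcal{R}_{D_0}$ is applied first), and the $r$-sets-Douglas-Rachford operator is $\mathcal{T}_{D_0,\ldots,D_{r-1}}:=\frac12\left(\mathrm{Id}+\mathcal{V}_{D_0,\ldots,D_{r-1}}\right)$. Given sets $C_0,\ldots,C_{m-1}$ and an integer $r\geq 2$, for each integer $d\geq 1$ the operator $S_d:\mathcal{H}\to\mathcal{H}$ is defined as $S_d:=\mathcal{T}_{D_0,\ldots,D_{r-1}}$ with $D_j:=C_{((r-1)(d-1)+j)\bmod m}$ for $j=0,1,\ldots,r-1$. (Thus the last set used in $S_d$ is the first set used in $S_{d+1}$.) $\operatorname{Fix}(h):=\{x\in\mathcal{H}\mid h(x)=x\}$. An operator $h:\mathcal{H}\to\mathcal{H}$ is nonexpansive if $\Vert h(x)-h(y)\Vert\leq\Vert x-y\Vert$ for all $x,y\in\mathcal{H}$. A sequence $\{x^k\}_{k=0}^{\infty}\subset\mathcal{H}$ is Fejér-monotone with respect to $D\subseteq\mathcal{H}$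 if $\Vert x^{k+1}-u\Vert\leq\Vert x^k-u\Vert$ for all $k\geq 0$ and all $u\in D$. *)

theory Defs
  imports "HOL-Analysis.Analysis"
begin

text \<open>
  A real Hilbert space is a type of sort \<open>{real_inner, complete_space}\<close>. The library's
  \<^const>\<open>closest_point\<close> additionally requires \<^class>\<open>heine_borel\<close>, which excludes
  infinite-dimensional spaces, so the metric projection is defined here by the same formula. Over
  a Hilbert space the selected point exists and is unique whenever \<open>D\<close> is nonempty, closed
  and convex; for other \<open>D\<close> the value is unspecified.
\<close>

definition metric_proj :: "'a::real_inner set \<Rightarrow> 'a \<Rightarrow> 'a" where
  "metric_proj D x = (SOME p. p \<in> D \<and> (\<forall>y\<in>D. dist x p \<le> dist x y))"

definition reflection :: "'a::real_inner set \<Rightarrow> 'a \<Rightarrow> 'a" where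
  "reflection D x = 2 *\<^sub>R metric_proj D x - x"

text \<open>
  The sets are given as a list \<open>[D\<^sub>0, \<dots>, D\<^sub>r\<^sub>-\<^sub>1]\<close>;
  \<^const>\<open>fold\<close> applies the reflection of the head first.
\<close>

definition composite_reflection :: "'a::real_inner set list \<Rightarrow> 'a \<Rightarrow> 'a" where
  "composite_reflection Ds = fold reflection Ds"

definition sets_DR :: "'a::real_inner set list \<Rightarrow> 'a \<Rightarrow> 'a" where
  "sets_DR Ds x = (1/2) *\<^sub>R (x + composite_reflection Ds x)"

text \<open>Only meaningful for \<open>d \<ge> 1\<close>, because \<open>d - 1\<close> is truncated subtraction.\<close>

definition cyclic_DR :: "nat \<Rightarrow> nat \<Rightarrow> (nat \<Rightarrow> 'a::real_inner set) \<Rightarrow> nat \<Rightarrow> 'a \<Rightarrow> 'a" where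
  "cyclic_DR m r C d = sets_DR (map (\<lambda>j. C (((r - 1) * (d - 1) + j) mod m)) [0..<r])"

definition Fix :: "('a \<Rightarrow> 'a) \<Rightarrow> 'a set" where
  "Fix h = {x. h x = x}"

definition nonexpansive :: "('a::real_normed_vector \<Rightarrow> 'a) \<Rightarrow> bool" where
  "nonexpansive h \<longleftrightarrow> (\<forall>x y. norm (h x - h y) \<le> norm (x - y))"

definition fejer_monotone :: "(nat \<Rightarrow> 'a::real_normed_vector) \<Rightarrow> 'a set \<Rightarrow> bool" where
  "fejer_monotone x D \<longleftrightarrow> (\<forall>k. \<forall>u\<in>D. norm (x (Suc k) - u) \<le> norm (x k - u))"

text \<open>
  Weak convergence in a Hilbert space: by the Riesz representation theorem the functionals
  \<open>\<lambda>v. v \<bullet> y\<close> are exactly the continuous linear functionals.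
\<close>

definition weakly_converges :: "(nat \<Rightarrow> 'a::real_inner) \<Rightarrow> 'a \<Rightarrow> bool" where
  "weakly_converges x l \<longleftrightarrow> (\<forall>y. (\<lambda>k. x k \<bullet> y) \<longlonglongrightarrow> l \<bullet> y)"

end

theory Submission
  imports Defs
begin

text \<open>
  A common point \<open>u\<close> of the sets is fixed by every reflection, so the composite reflection
  does not increase the distance to \<open>u\<close>, and averaging it with the identity yields
  \<open>\<parallel>S\<^sub>k x - u\<parallel>\<^sup>2 + \<parallel>S\<^sub>k x - x\<parallel>\<^sup>2 \<le> \<parallel>x - u\<parallel>\<^sup>2\<close>. Hence \<open>x\<^sup>k\<^sup>+\<^sup>1 - x\<^sup>k \<rightarrow> 0\<close> and, by (3),
  \<open>S x\<^sup>k - x\<^sup>k \<rightarrow> 0\<close>.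

  Weak compactness of bounded sets is avoided by means of asymptotic centers. For a filter \<open>F\<close>
  finer than \<open>sequentially\<close>, the function \<open>u \<mapsto> limsup\<^sub>F \<parallel>x\<^sup>k - u\<parallel>\<^sup>2\<close> is strongly convex, so it has
  a unique minimizer, which is fixed by \<open>S\<close> because \<open>S\<close> is nonexpansive and
  \<open>S x\<^sup>k - x\<^sup>k \<rightarrow> 0\<close>. On \<open>Fix S\<close> this function does not depend on \<open>F\<close>, by Fejer monotonicity.
  Thus all these filters share one asymptotic center \<open>l\<close>. If \<open>\<langle>x\<^sup>k - l, y\<rangle> \<ge> \<epsilon> > 0\<close>
  held along some \<open>F\<close>, then moving from \<open>l\<close> a little towards \<open>y\<close> would decrease the function.
\<close>

section \<open>Minimizers of strongly convex functions\<close>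

text \<open>By \<open>strong\<close>, two near-minimizers must be close, since otherwise their
  midpoint would fall below the infimum. So a minimizing sequence is Cauchy, and completeness takes
  the place of compactness. This serves both metric projections and asymptotic centers.\<close>

lemma strongly_convex_minimizer_exists:
  fixes f :: "'a::{real_normed_vector, complete_space} \<Rightarrow> real"
  assumes D: "closed D" "convex D" "D \<noteq> {}"
    and cont: "continuous_on D f"
    and bdd: "\<And>u. u \<in> D \<Longrightarrow> c \<le> f u"
    and strong: "\<And>u v. u \<in> D \<Longrightarrow> v \<in> D \<Longrightarrow>
      f (midpoint u v) \<le> (f u + f v) / 2 - (dist u v)\<^sup>2 / 4"
  shows "\<exists>p\<in>D. \<forall>u\<in>D. f p \<le> f u"
proof -
  define I where "I = Inf (f ` D)"
  have bb: "bdd_below (f ` D)" using bdd by (auto simp: bdd_below_def)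
  have I_le: "I \<le> f u" if "u \<in> D" for u
    unfolding I_def using bb that by (simp add: cINF_lower)
  have "\<exists>u\<in>D. f u < I + inverse (real (Suc n))" for n
  proof -
    have "I < I + inverse (real (Suc n))" by simp
    then show ?thesis
      unfolding I_def using cINF_less_iff[OF D(3) bb] by blast
  qed
  then obtain s where s: "\<And>n. s n \<in> D" "\<And>n. f (s n) < I + inverse (real (Suc n))"
    by metis
  have close: "(dist (s i) (s j))\<^sup>2 \<le> 4 * inverse (real (Suc n))" if "n \<le> i" "n \<le> j" for i j n
  proof -
    have "midpoint (s i) (s j) \<in> D"
      using convexD[OF D(2) s(1)[of i] s(1)[of j], of "1/2" "1/2"]
      by (simp add: midpoint_def scaleR_add_right)
    then have "I \<le> (f (s i) + f (s j)) / 2 - (dist (s i) (s j))\<^sup>2 / 4"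
      using I_le strong[OF s(1) s(1)] by (meson order_trans)
    moreover have "f (s k) < I + inverse (real (Suc n))" if "n \<le> k" for k
    proof -
      have "inverse (real (Suc k)) \<le> inverse (real (Suc n))"
        using that by (auto intro!: le_imp_inverse_le)
      then show ?thesis using s(2)[of k] by (meson add_left_mono less_le_trans)
    qed
    note this[OF that(1)] this[OF that(2)]
    ultimately show ?thesis by argo
  qed
  have "Cauchy s"
  proof (rule metric_CauchyI)
    fix e :: real assume "e > 0"
    then obtain n where n: "inverse (real (Suc n)) < e\<^sup>2 / 4"
      using reals_Archimedean[of "e\<^sup>2 / 4"] by auto
    have "dist (s i) (s j) < e" if "i \<ge> n" "j \<ge> n" for i j
      using close[OF that] n \<open>e > 0\<close> by (intro power_less_imp_less_base[of _ 2 e]) auto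
    then show "\<exists>M. \<forall>i\<ge>M. \<forall>j\<ge>M. dist (s i) (s j) < e" by blast
  qed
  then obtain p where p: "s \<longlonglongrightarrow> p"
    using Cauchy_convergent convergent_def by blast
  have pD: "p \<in> D" using D(1) s(1) p closed_sequentially by blast
  have "(\<lambda>n. f (s n)) \<longlonglongrightarrow> f p"
    using cont pD s(1) p by (auto simp: continuous_on_sequentially o_def)
  moreover have "(\<lambda>n. I + inverse (real (Suc n))) \<longlonglongrightarrow> I"
    using LIMSEQ_inverse_real_of_nat_add by blast
  ultimately have "f p \<le> I"
    by (rule LIMSEQ_le) (use s(2) in \<open>auto intro: less_imp_le\<close>)
  with I_le pD show ?thesis by force
qed

text \<open>The parallelogram law for \<open>w - u\<close> and \<open>w - v\<close>, arranged as the
  strong convexity of the squared distance to \<open>w\<close>.\<close>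

lemma norm_midpoint_diff_sq:
  fixes w u v :: "'a::real_inner"
  shows "(norm (w - midpoint u v))\<^sup>2 =
    ((norm (w - u))\<^sup>2 + (norm (w - v))\<^sup>2) / 2 - (dist u v)\<^sup>2 / 4"
  by (simp add: power2_norm_eq_inner dist_norm midpoint_def inner_diff inner_add inner_commute
      field_simps)

section \<open>Metric projections and Douglas-Rachford operators\<close>

lemma metric_proj:
  fixes D :: "'a::{real_inner, complete_space} set"
  assumes "closed D" "convex D" "D \<noteq> {}"
  shows "metric_proj D x \<in> D" "\<forall>y\<in>D. dist x (metric_proj D x) \<le> dist x y"
proof -
  \<comment> \<open>The distance is squared because only the square satisfies the midpoint
    inequality.\<close>
  have "\<exists>p\<in>D. \<forall>u\<in>D. (norm (x - p))\<^sup>2 \<le> (norm (x - u))\<^sup>2"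
    by (rule strongly_convex_minimizer_exists[OF assms, where c = 0])
      (auto intro!: continuous_intros simp: norm_midpoint_diff_sq)
  then have "\<exists>p. p \<in> D \<and> (\<forall>y\<in>D. dist x p \<le> dist x y)"
    by (auto simp: dist_norm)
  then have "metric_proj D x \<in> D \<and> (\<forall>y\<in>D. dist x (metric_proj D x) \<le> dist x y)"
    unfolding metric_proj_def by (rule someI_ex)
  then show "metric_proj D x \<in> D" "\<forall>y\<in>D. dist x (metric_proj D x) \<le> dist x y" by auto
qed

text \<open>With \<open>a = x - p\<close> and \<open>b = u - p\<close> the two vectors are
  \<open>-(a + b)\<close> and \<open>a - b\<close>. Their squared norms differ by
  \<open>4 * inner a b\<close>, which is nonpositive by the variational inequality of the
  projection.\<close>

lemma reflection_quasi_nonexpansive: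
  fixes D :: "'a::{real_inner, complete_space} set"
  assumes "closed D" "convex D" "u \<in> D"
  shows "norm (reflection D x - u) \<le> norm (x - u)"
proof -
  define p where "p = metric_proj D x"
  have "D \<noteq> {}" using assms by auto
  then have "inner (x - p) (u - p) \<le> 0"
    unfolding p_def using metric_proj[OF assms(1,2)] assms by (intro any_closest_point_dot) auto
  moreover have "(norm (2 *\<^sub>R p - x - u))\<^sup>2 = (norm (x - u))\<^sup>2 + 4 * inner (x - p) (u - p)"
    by (simp add: power2_norm_eq_inner inner_diff inner_commute algebra_simps)
  ultimately have "(norm (2 *\<^sub>R p - x - u))\<^sup>2 \<le> (norm (x - u))\<^sup>2" by simp
  then show ?thesis
    unfolding reflection_def p_def[symmetric] by (rule power2_le_imp_le) simp
qed

lemma composite_reflection_quasi_nonexpansive: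
  fixes Ds :: "'a::{real_inner, complete_space} set list"
  assumes "\<And>D. D \<in> set Ds \<Longrightarrow> closed D \<and> convex D \<and> u \<in> D"
  shows "norm (composite_reflection Ds x - u) \<le> norm (x - u)"
  using assms unfolding composite_reflection_def
proof (induction Ds arbitrary: x)
  case (Cons D Ds)
  have "norm (fold reflection Ds (reflection D x) - u) \<le> norm (reflection D x - u)"
    using Cons by simp
  also have "\<dots> \<le> norm (x - u)"
    using Cons.prems by (intro reflection_quasi_nonexpansive) auto
  finally show ?case by simp
qed simp

text \<open>The new point is the midpoint of \<open>x\<close> and \<open>v\<close>. The term that
  the parallelogram law subtracts, a quarter of the squared distance from \<open>x\<close> to
  \<open>v\<close>, is exactly the squared step length.\<close>

lemma sets_DR_decrease:
  fixes Ds :: "'a::{real_inner, complete_space} set list"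
  assumes "\<And>D. D \<in> set Ds \<Longrightarrow> closed D \<and> convex D \<and> u \<in> D"
  shows "(norm (sets_DR Ds x - u))\<^sup>2 + (norm (sets_DR Ds x - x))\<^sup>2 \<le> (norm (x - u))\<^sup>2"
proof -
  define v where "v = composite_reflection Ds x"
  have "norm (v - u) \<le> norm (x - u)"
    unfolding v_def by (rule composite_reflection_quasi_nonexpansive[OF assms])
  then have v: "(norm (v - u))\<^sup>2 \<le> (norm (x - u))\<^sup>2" by (simp add: power_mono)
  have eq: "sets_DR Ds x = midpoint x v" by (simp add: sets_DR_def midpoint_def v_def)
  have "(norm (midpoint x v - x))\<^sup>2 = (dist x v)\<^sup>2 / 4"
    by (simp add: dist_norm[symmetric] dist_midpoint power_divide)
  moreover have "(norm (midpoint x v - u))\<^sup>2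
      = ((norm (x - u))\<^sup>2 + (norm (v - u))\<^sup>2) / 2 - (dist x v)\<^sup>2 / 4"
    using norm_midpoint_diff_sq[of u x v] by (simp only: norm_minus_commute[of u])
  ultimately show ?thesis using v unfolding eq by argo
qed

section \<open>Asymptotic centers\<close>

text \<open>
  The square of the asymptotic radius, \<open>limsup\<^sub>F \<parallel>x\<^sub>k - u\<parallel>\<^sup>2\<close>, as a real number; it is
  meaningful only for bounded \<open>x\<close> and \<open>F \<noteq> bot\<close>.
\<close>

definition asymptotic_sqdist :: "('i \<Rightarrow> 'a::real_normed_vector) \<Rightarrow> 'i filter \<Rightarrow> 'a \<Rightarrow> real" where
  "asymptotic_sqdist x F u = Inf {b. \<forall>\<^sub>F k in F. (norm (x k - u))\<^sup>2 \<le> b}"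

lemma asymptotic_sqdist_le:
  assumes "F \<noteq> bot" "\<forall>\<^sub>F k in F. (norm (x k - u))\<^sup>2 \<le> b"
  shows "asymptotic_sqdist x F u \<le> b"
proof -
  \<comment> \<open>For \<open>F = bot\<close> every real would be an eventual bound, and the
    infimum would be meaningless.\<close>
  have "0 \<le> b" if "\<forall>\<^sub>F k in F. (norm (x k - u))\<^sup>2 \<le> b" for b
    using eventually_happens'[OF assms(1) that] by (meson order_trans zero_le_power2)
  then have "bdd_below {b. \<forall>\<^sub>F k in F. (norm (x k - u))\<^sup>2 \<le> b}"
    by (auto simp: bdd_below_def)
  then show ?thesis
    unfolding asymptotic_sqdist_def using assms(2) by (auto intro: cInf_lower)
qed

lemma eventually_le_of_asymptotic_sqdist_less:
  assumes "bounded (range x)" "asymptotic_sqdist x F u < b"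
  shows "\<forall>\<^sub>F k in F. (norm (x k - u))\<^sup>2 \<le> b"
proof -
  obtain B where B: "\<And>k. norm (x k) \<le> B"
    using assms(1) by (auto simp: bounded_iff)
  have "(norm (x k - u))\<^sup>2 \<le> (B + norm u)\<^sup>2" for k
    using B[of k] norm_triangle_ineq4[of "x k" u] by (intro power_mono) auto
  then have "(B + norm u)\<^sup>2 \<in> {b. \<forall>\<^sub>F k in F. (norm (x k - u))\<^sup>2 \<le> b}" by simp
  then have "{b. \<forall>\<^sub>F k in F. (norm (x k - u))\<^sup>2 \<le> b} \<noteq> {}" by blast
  from cInf_lessD[OF this assms(2)[unfolded asymptotic_sqdist_def]]
  obtain c where "\<forall>\<^sub>F k in F. (norm (x k - u))\<^sup>2 \<le> c" "c < b"
    by auto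
  then show ?thesis by (auto elim!: eventually_mono)
qed

text \<open>Passes a pointwise comparison to upper limits. The offset \<open>c\<close> serves as a
  modulus of continuity, as zero for the fixed-point argument, and as a negative gain for the
  descent argument.\<close>

lemma asymptotic_sqdist_compare:
  assumes "F \<noteq> bot" "bounded (range x)"
    and "\<And>e. e > 0 \<Longrightarrow> \<forall>\<^sub>F k in F. (norm (x k - v))\<^sup>2 \<le> (norm (x k - u))\<^sup>2 + c + e"
  shows "asymptotic_sqdist x F v \<le> asymptotic_sqdist x F u + c"
proof (rule field_le_epsilon)
  fix e :: real assume "e > 0"
  have "\<forall>\<^sub>F k in F. (norm (x k - u))\<^sup>2 \<le> asymptotic_sqdist x F u + e / 2"
    using \<open>e > 0\<close> by (intro eventually_le_of_asymptotic_sqdist_less assms) simp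
  moreover have "\<forall>\<^sub>F k in F. (norm (x k - v))\<^sup>2 \<le> (norm (x k - u))\<^sup>2 + c + e / 2"
    using assms(3) \<open>e > 0\<close> by simp
  ultimately have "\<forall>\<^sub>F k in F. (norm (x k - v))\<^sup>2 \<le> asymptotic_sqdist x F u + c + e"
    by eventually_elim linarith
  then show "asymptotic_sqdist x F v \<le> asymptotic_sqdist x F u + c + e"
    by (rule asymptotic_sqdist_le[OF assms(1)])
qed

lemma asymptotic_sqdist_eq_lim:
  assumes "F \<noteq> bot" "bounded (range x)" "((\<lambda>k. (norm (x k - u))\<^sup>2) \<longlongrightarrow> g) F"
  shows "asymptotic_sqdist x F u = g"
proof (rule antisym)
  show "asymptotic_sqdist x F u \<le> g"
  proof (rule field_le_epsilon)
    fix e :: real assume "e > 0"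
    then have "\<forall>\<^sub>F k in F. (norm (x k - u))\<^sup>2 < g + e"
      using assms(3) by (simp add: order_tendstoD(2))
    then show "asymptotic_sqdist x F u \<le> g + e"
      by (intro asymptotic_sqdist_le[OF assms(1)]) (auto elim: eventually_mono)
  qed
  show "g \<le> asymptotic_sqdist x F u"
  proof (rule field_le_epsilon)
    fix e :: real assume "e > 0"
    then have "\<forall>\<^sub>F k in F. (norm (x k - u))\<^sup>2 \<le> asymptotic_sqdist x F u + e"
      by (intro eventually_le_of_asymptotic_sqdist_less assms) simp
    then show "g \<le> asymptotic_sqdist x F u + e"
      using tendsto_upperbound[OF assms(3) _ assms(1)] by blast
  qed
qed

text \<open>The parallelogram law subtracts the same term for every \<open>k\<close>, so strong
  convexity survives the upper limit.\<close>

lemma asymptotic_sqdist_midpoint: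
  fixes x :: "'i \<Rightarrow> 'a::real_inner"
  assumes "F \<noteq> bot" "bounded (range x)"
  shows "asymptotic_sqdist x F (midpoint u v) \<le>
    (asymptotic_sqdist x F u + asymptotic_sqdist x F v) / 2 - (dist u v)\<^sup>2 / 4"
proof (rule field_le_epsilon)
  fix e :: real assume "e > 0"
  have *: "\<forall>\<^sub>F k in F. (norm (x k - w))\<^sup>2 \<le> asymptotic_sqdist x F w + e" for w
    using \<open>e > 0\<close> by (intro eventually_le_of_asymptotic_sqdist_less assms) simp
  show "asymptotic_sqdist x F (midpoint u v) \<le>
    (asymptotic_sqdist x F u + asymptotic_sqdist x F v) / 2 - (dist u v)\<^sup>2 / 4 + e"
    using *[of u] *[of v]
    by (intro asymptotic_sqdist_le[OF assms(1)], eventually_elim)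
      (simp add: norm_midpoint_diff_sq field_simps)
qed

lemma continuous_asymptotic_sqdist:
  fixes x :: "'i \<Rightarrow> 'a::real_normed_vector"
  assumes "F \<noteq> bot" "bounded (range x)"
  shows "continuous_on UNIV (asymptotic_sqdist x F)"
proof -
  obtain B where B: "\<And>k. norm (x k) \<le> B"
    using assms(2) by (auto simp: bounded_iff)
  \<comment> \<open>Factor the difference of the two squared norms: their difference is at most
    \<open>norm (u - v)\<close> and their sum at most the second factor.\<close>
  define c where "c u v = norm (u - v) * (2 * B + norm u + norm v)" for u v :: 'a
  have le: "asymptotic_sqdist x F v \<le> asymptotic_sqdist x F u + c u v" for u v
  proof (rule asymptotic_sqdist_compare[OF assms])
    fix e :: real assume "e > 0"
    have "(norm (x k - v))\<^sup>2 \<le> (norm (x k - u))\<^sup>2 + c u v + e" for k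
    proof -
      have "(norm (x k - v))\<^sup>2 - (norm (x k - u))\<^sup>2
          = (norm (x k - v) - norm (x k - u)) * (norm (x k - v) + norm (x k - u))"
        by (simp add: power2_eq_square algebra_simps)
      also have "\<dots> \<le> norm (u - v) * (norm (x k - v) + norm (x k - u))"
        using norm_triangle_ineq[of "x k - u" "u - v"] by (intro mult_right_mono) auto
      also have "\<dots> \<le> c u v"
        unfolding c_def using B[of k] norm_triangle_ineq4[of "x k" u] norm_triangle_ineq4[of "x k" v]
        by (intro mult_left_mono) auto
      finally show ?thesis using \<open>e > 0\<close> by simp
    qed
    then show "\<forall>\<^sub>F k in F. (norm (x k - v))\<^sup>2 \<le> (norm (x k - u))\<^sup>2 + c u v + e" by simp
  qed
  have "(asymptotic_sqdist x F \<longlongrightarrow> asymptotic_sqdist x F u) (at u)" for u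
  proof (rule tendsto_sandwich)
    have c0: "((\<lambda>v. c u v) \<longlongrightarrow> 0) (at u)" "((\<lambda>v. c v u) \<longlongrightarrow> 0) (at u)"
      unfolding c_def by (auto intro!: tendsto_eq_intros)
    show "((\<lambda>v. asymptotic_sqdist x F u - c v u) \<longlongrightarrow> asymptotic_sqdist x F u) (at u)"
      using tendsto_diff[OF tendsto_const c0(2)] by simp
    show "((\<lambda>v. asymptotic_sqdist x F u + c u v) \<longlongrightarrow> asymptotic_sqdist x F u) (at u)"
      using tendsto_add[OF tendsto_const c0(1)] by simp
    show "\<forall>\<^sub>F v in at u. asymptotic_sqdist x F u - c v u \<le> asymptotic_sqdist x F v"
      using le[where v = u] by (simp add: algebra_simps)
  qed (simp add: le)
  then show ?thesis by (simp add: continuous_on_def)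
qed

lemma asymptotic_center_exists:
  fixes x :: "'i \<Rightarrow> 'a::{real_inner, complete_space}"
  assumes "F \<noteq> bot" "bounded (range x)"
  shows "\<exists>c. \<forall>u. asymptotic_sqdist x F c \<le> asymptotic_sqdist x F u"
proof -
  have "0 \<le> asymptotic_sqdist x F u" for u
  proof (rule field_le_epsilon)
    fix e :: real assume "e > 0"
    then have "\<forall>\<^sub>F k in F. (norm (x k - u))\<^sup>2 \<le> asymptotic_sqdist x F u + e"
      by (intro eventually_le_of_asymptotic_sqdist_less assms) simp
    from eventually_happens'[OF assms(1) this] show "0 \<le> asymptotic_sqdist x F u + e"
      by (meson order_trans zero_le_power2)
  qed
  then have "\<exists>c\<in>UNIV. \<forall>u\<in>UNIV. asymptotic_sqdist x F c \<le> asymptotic_sqdist x F u"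
    by (intro strongly_convex_minimizer_exists continuous_asymptotic_sqdist
        asymptotic_sqdist_midpoint assms) auto
  then show ?thesis by blast
qed

text \<open>The midpoint of two distinct minimizers would have a strictly smaller value.\<close>

lemma asymptotic_center_unique:
  fixes x :: "'i \<Rightarrow> 'a::real_inner"
  assumes "F \<noteq> bot" "bounded (range x)"
    and "\<And>u. asymptotic_sqdist x F c \<le> asymptotic_sqdist x F u"
    and "asymptotic_sqdist x F d \<le> asymptotic_sqdist x F c"
  shows "d = c"
proof -
  have "(dist c d)\<^sup>2 \<le> 0"
    using asymptotic_sqdist_midpoint[OF assms(1,2), of c d] assms(3)[of "midpoint c d"] assms(4)
    by argo
  then show ?thesis by simp
qed

text \<open>Since \<open>S (x k)\<close> is close to \<open>x k\<close> and \<open>S\<close> is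
  nonexpansive, \<open>S c\<close> is asymptotically no farther from the sequence than
  \<open>c\<close>. Uniqueness of the center then gives equality.\<close>

lemma asymptotic_center_fixed:
  fixes x :: "'i \<Rightarrow> 'a::real_inner"
  assumes "F \<noteq> bot" "bounded (range x)" "nonexpansive S"
    and center: "\<And>u. asymptotic_sqdist x F c \<le> asymptotic_sqdist x F u"
    and lim: "((\<lambda>k. S (x k) - x k) \<longlongrightarrow> 0) F"
  shows "S c = c"
proof (rule asymptotic_center_unique[OF assms(1,2) center])
  obtain B where B: "\<And>k. norm (x k) \<le> B"
    using assms(2) by (auto simp: bounded_iff)
  \<comment> \<open>This expression bounds the excess of
    \<open>(?a + norm (x k - c))\<^sup>2\<close> over \<open>(norm (x k - c))\<^sup>2\<close>,
    because \<open>norm (x k - c)\<close> is at most \<open>B + norm c\<close>.\<close>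
  have "((\<lambda>k. norm (S (x k) - x k) * (norm (S (x k) - x k) + 2 * (B + norm c))) \<longlongrightarrow> 0) F"
    by (rule tendsto_eq_intros tendsto_norm_zero[OF lim] refl)+ simp
  then have small: "\<forall>\<^sub>F k in F. norm (S (x k) - x k) * (norm (S (x k) - x k) + 2 * (B + norm c)) < e"
    if "e > 0" for e
    using that by (rule order_tendstoD(2))
  have "asymptotic_sqdist x F (S c) \<le> asymptotic_sqdist x F c + 0"
  proof (rule asymptotic_sqdist_compare[OF assms(1,2)])
    fix e :: real assume "e > 0"
    from small[OF this]
    show "\<forall>\<^sub>F k in F. (norm (x k - S c))\<^sup>2 \<le> (norm (x k - c))\<^sup>2 + 0 + e"
    proof eventually_elim
      case (elim k)
      let ?a = "norm (S (x k) - x k)"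
      have "norm (x k - S c) \<le> ?a + norm (S (x k) - S c)"
        using norm_triangle_ineq[of "x k - S (x k)" "S (x k) - S c"]
        by (simp add: norm_minus_commute)
      also have "norm (S (x k) - S c) \<le> norm (x k - c)"
        using assms(3) by (simp add: nonexpansive_def)
      finally have "(norm (x k - S c))\<^sup>2 \<le> (?a + norm (x k - c))\<^sup>2"
        by (simp add: power_mono)
      also have "\<dots> = (norm (x k - c))\<^sup>2 + ?a * (?a + 2 * norm (x k - c))"
        by (simp add: power2_eq_square algebra_simps)
      also have "?a * (?a + 2 * norm (x k - c)) \<le> ?a * (?a + 2 * (B + norm c))"
        using B[of k] norm_triangle_ineq4[of "x k" c] by (intro mult_left_mono) auto
      finally show ?case using elim by simp
    qed
  qed
  then show "asymptotic_sqdist x F (S c) \<le> asymptotic_sqdist x F c" by simp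
qed

lemma asymptotic_center_inner:
  fixes x :: "'i \<Rightarrow> 'a::real_inner"
  assumes "F \<noteq> bot" "bounded (range x)"
    and center: "\<And>u. asymptotic_sqdist x F c \<le> asymptotic_sqdist x F u"
    and ev: "\<forall>\<^sub>F k in F. e \<le> inner (x k - c) y"
  shows "e \<le> 0"
proof (rule ccontr)
  assume "\<not> e \<le> 0"
  then have e: "e > 0" by simp
  \<comment> \<open>Moving by \<open>t *\<^sub>R y\<close> changes the squared distance by at most
    \<open>- 2 * t * e + t\<^sup>2 * (norm y)\<^sup>2\<close>. This \<open>t\<close> makes the
    quadratic term smaller than \<open>t * e\<close>, leaving a gain of \<open>t * e\<close>; the
    summand 1 covers \<open>y = 0\<close>.\<close>
  define t where "t = e / (1 + (norm y)\<^sup>2)"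
  have pos: "1 + (norm y)\<^sup>2 > 0" by (simp add: add_pos_nonneg)
  then have t: "t > 0" "t * (1 + (norm y)\<^sup>2) = e" using e by (auto simp: t_def)
  have "t * (norm y)\<^sup>2 < e" using t by (simp add: algebra_simps)
  then have gain: "t * (t * (norm y)\<^sup>2) < t * e" using t(1) by (rule mult_strict_left_mono)
  have "asymptotic_sqdist x F (c + t *\<^sub>R y) \<le> asymptotic_sqdist x F c + (- (t * e))"
  proof (rule asymptotic_sqdist_compare[OF assms(1,2)])
    fix d :: real assume "d > 0"
    show "\<forall>\<^sub>F k in F. (norm (x k - (c + t *\<^sub>R y)))\<^sup>2 \<le> (norm (x k - c))\<^sup>2 + (- (t * e)) + d"
      using ev
    proof eventually_elim
      case (elim k)
      have "(norm (x k - (c + t *\<^sub>R y)))\<^sup>2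
          = (norm (x k - c))\<^sup>2 - 2 * (t * inner (x k - c) y) + t * (t * (norm y)\<^sup>2)"
        by (simp add: power2_norm_eq_inner inner_diff inner_add inner_commute algebra_simps)
      moreover have "t * e \<le> t * inner (x k - c) y"
        using elim t(1) by (intro mult_left_mono) auto
      ultimately show ?case using gain \<open>d > 0\<close> by linarith
    qed
  qed
  with center[of "c + t *\<^sub>R y"] have "t * e \<le> 0" by linarith
  with t(1) e show False by (simp add: mult_le_0_iff)
qed

section \<open>Weak convergence of Fejer-monotone sequences\<close>

lemma fejer_monotone_norm_convergent:
  assumes "fejer_monotone x D" "u \<in> D"
  shows "\<exists>g. (\<lambda>k. (norm (x k - u))\<^sup>2) \<longlonglongrightarrow> g"
proof -
  have "decseq (\<lambda>k. (norm (x k - u))\<^sup>2)"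
    using assms by (auto simp: decseq_Suc_iff fejer_monotone_def intro!: power_mono)
  then show ?thesis
    by (rule decseq_convergent[of _ 0]) auto
qed

lemma fejer_monotone_bounded:
  assumes "fejer_monotone x D" "D \<noteq> {}"
  shows "bounded (range x)"
proof -
  obtain u where u: "u \<in> D" using assms(2) by blast
  have "norm (x k - u) \<le> norm (x 0 - u)" for k
    using assms(1) u by (induction k) (auto simp: fejer_monotone_def intro: order_trans)
  then have "range x \<subseteq> cball u (norm (x 0 - u))"
    by (auto simp: dist_norm norm_minus_commute)
  then show ?thesis using bounded_cball bounded_subset by blast
qed

text \<open>Isolates the part that is independent of the reflections: they enter only through Fejer
  monotonicity and the vanishing of \<open>S (x k) - x k\<close>.\<close>

lemma fejer_monotone_weakly_converges:
  fixes x :: "nat \<Rightarrow> 'a::{real_inner, complete_space}"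
  assumes S: "nonexpansive S" "Fix S \<noteq> {}"
    and fejer: "fejer_monotone x (Fix S)"
    and lim: "(\<lambda>k. S (x k) - x k) \<longlonglongrightarrow> 0"
  shows "\<exists>l\<in>Fix S. weakly_converges x l"
proof -
  have bdd: "bounded (range x)" using fejer S(2) by (rule fejer_monotone_bounded)
  have seq: "sequentially \<noteq> bot" by simp
  obtain l where l: "\<And>u. asymptotic_sqdist x sequentially l \<le> asymptotic_sqdist x sequentially u"
    using asymptotic_center_exists[OF seq bdd] by blast
  have lS: "l \<in> Fix S"
    using asymptotic_center_fixed[OF seq bdd S(1) l lim] by (simp add: Fix_def)
  \<comment> \<open>The center \<open>c\<close> for \<open>F\<close> also lies in
    \<open>Fix S\<close>, where the values for \<open>F\<close> and \<open>sequentially\<close>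
    agree. Minimality of \<open>l\<close> for \<open>sequentially\<close> therefore transfers to
    \<open>F\<close>.\<close>
  have center: "asymptotic_sqdist x F l \<le> asymptotic_sqdist x F u"
    if F: "F \<noteq> bot" "F \<le> sequentially" for F u
  proof -
    obtain c where c: "\<And>u. asymptotic_sqdist x F c \<le> asymptotic_sqdist x F u"
      using asymptotic_center_exists[OF F(1) bdd] by blast
    have cS: "c \<in> Fix S"
      using asymptotic_center_fixed[OF F(1) bdd S(1) c tendsto_mono[OF F(2) lim]]
      by (simp add: Fix_def)
    have same: "asymptotic_sqdist x F v = asymptotic_sqdist x sequentially v" if v: "v \<in> Fix S" for v
    proof -
      obtain g where g: "(\<lambda>k. (norm (x k - v))\<^sup>2) \<longlonglongrightarrow> g"
        using fejer_monotone_norm_convergent[OF fejer v] by blast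
      show ?thesis
        using asymptotic_sqdist_eq_lim[OF seq bdd g]
          asymptotic_sqdist_eq_lim[OF F(1) bdd tendsto_mono[OF F(2) g]] by simp
    qed
    have "asymptotic_sqdist x F l \<le> asymptotic_sqdist x F c"
      using l[of c] same[OF lS] same[OF cS] by simp
    then show ?thesis using c[of u] by linarith
  qed
  have ev: "\<forall>\<^sub>F k in sequentially. inner (x k - l) y < e" if "e > 0" for y e
  proof (rule ccontr)
    assume neg: "\<not> (\<forall>\<^sub>F k in sequentially. inner (x k - l) y < e)"
    \<comment> \<open>Restricting to the offending indices plays the role of a subsequence; the
      filter is proper because these indices occur infinitely often.\<close>
    define F where "F = inf sequentially (principal {k. e \<le> inner (x k - l) y})"
    have "F \<noteq> bot"
      using neg by (auto simp: F_def trivial_limit_def eventually_inf_principal not_le)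
    moreover have "F \<le> sequentially" by (simp add: F_def)
    moreover have "\<forall>\<^sub>F k in F. e \<le> inner (x k - l) y"
      by (simp add: F_def eventually_inf_principal)
    ultimately have "e \<le> 0"
      using center by (intro asymptotic_center_inner[OF _ bdd]) auto
    with \<open>e > 0\<close> show False by simp
  qed
  have "(\<lambda>k. inner (x k) y) \<longlonglongrightarrow> inner l y" for y
  proof (rule tendstoI)
    fix e :: real assume "e > 0"
    show "\<forall>\<^sub>F k in sequentially. dist (inner (x k) y) (inner l y) < e"
      \<comment> \<open>The one-sided bound for \<open>y\<close> and \<open>- y\<close> together
        controls the absolute value.\<close>
      using ev[OF \<open>e > 0\<close>, of y] ev[OF \<open>e > 0\<close>, of "- y"]
      by eventually_elim (auto simp: dist_real_def inner_diff_left abs_less_iff)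
  qed
  with lS show ?thesis by (auto simp: weakly_converges_def)
qed

section \<open>Weak convergence of the cyclic Douglas-Rachford iteration\<close>

theorem theorem3p4:
  fixes C :: "nat \<Rightarrow> 'a::{real_inner, complete_space} set"
    and m r :: nat
    and x :: "nat \<Rightarrow> 'a"
    and S :: "'a \<Rightarrow> 'a"
  assumes "m \<ge> 1" and "r \<ge> 2"
    and "\<And>i. i < m \<Longrightarrow> C i \<noteq> {}"
    and "\<And>i. i < m \<Longrightarrow> closed (C i)"
    and "\<And>i. i < m \<Longrightarrow> convex (C i)"
    and "interior (\<Inter>i<m. C i) \<noteq> {}"
    and "\<And>k. x (Suc k) = cyclic_DR m r C (Suc k) (x k)"
    and "nonexpansive S"
    and "Fix S \<noteq> {}"
    and "Fix S \<subseteq> (\<Inter>k\<in>{1..}. Fix (cyclic_DR m r C k)) \<inter> (\<Inter>i<m. C i)"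
    and "fejer_monotone x (Fix S)"
    and "\<exists>\<beta>>0. \<forall>k. norm (cyclic_DR m r C (Suc k) (x k) - x k) \<ge> \<beta> * norm (S (x k) - x k)"
  shows "\<exists>xs. weakly_converges x xs \<and> xs \<in> Fix S \<and> xs \<in> (\<Inter>i<m. C i)"
proof -
  obtain u where u: "u \<in> Fix S" using assms(9) by blast
  then have uC: "u \<in> C i" if "i < m" for i using assms(10) that by auto
  \<comment> \<open>Indices taken modulo \<open>m\<close> stay below \<open>m\<close> because
    \<open>m \<ge> 1\<close>, so \<open>u\<close> lies in every set used by the operator.\<close>
  have decrease: "(norm (x (Suc k) - u))\<^sup>2 + (norm (x (Suc k) - x k))\<^sup>2 \<le> (norm (x k - u))\<^sup>2" for k
    unfolding assms(7)[of k] cyclic_DR_def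
    using assms(1,4,5) uC by (intro sets_DR_decrease) auto
  obtain g where g: "(\<lambda>k. (norm (x k - u))\<^sup>2) \<longlonglongrightarrow> g"
    using fejer_monotone_norm_convergent[OF assms(11) u] by blast
  \<comment> \<open>The squared steps are dominated by consecutive differences of a convergent
    sequence.\<close>
  have "(\<lambda>k. (norm (x (Suc k) - x k))\<^sup>2) \<longlonglongrightarrow> 0"
  proof (rule Lim_null_comparison)
    show "\<forall>\<^sub>F k in sequentially. norm ((norm (x (Suc k) - x k))\<^sup>2)
        \<le> (norm (x k - u))\<^sup>2 - (norm (x (Suc k) - u))\<^sup>2"
      using decrease by (simp add: algebra_simps)
    show "(\<lambda>k. (norm (x k - u))\<^sup>2 - (norm (x (Suc k) - u))\<^sup>2) \<longlonglongrightarrow> 0"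
      using tendsto_diff[OF g LIMSEQ_Suc[OF g]] by simp
  qed
  then have step: "(\<lambda>k. norm (x (Suc k) - x k)) \<longlonglongrightarrow> 0"
    using tendsto_real_sqrt by fastforce
  obtain \<beta> where \<beta>: "\<beta> > 0"
      "\<And>k. \<beta> * norm (S (x k) - x k) \<le> norm (x (Suc k) - x k)"
    using assms(12) unfolding assms(7)[symmetric] by blast
  have "(\<lambda>k. S (x k) - x k) \<longlonglongrightarrow> 0"
  proof (rule Lim_null_comparison)
    show "\<forall>\<^sub>F k in sequentially. norm (S (x k) - x k) \<le> norm (x (Suc k) - x k) / \<beta>"
      using \<beta> by (simp add: field_simps)
    show "(\<lambda>k. norm (x (Suc k) - x k) / \<beta>) \<longlonglongrightarrow> 0"
      using tendsto_divide_zero[OF step] .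
  qed
  then obtain l where "l \<in> Fix S" "weakly_converges x l"
    using fejer_monotone_weakly_converges[OF assms(8,9,11)] by blast
  then show ?thesis using assms(10) by blast
qed

end
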